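(* Let $(V,\omega)$ be a $\mathbb{Z}$-graded conformal vertex algebra over $\mathbb{K}$. Assume that $a\in V_{\ge2}$ satisfies the following conditions: $\mathrm{pr}_2(a)=\omega$, $a(0)=T$, $a(1)a=2a$; $a(1)$ is semisimple on $V$; and the eigenvalues of $a(1)$ are integers. Then there exists a unique $\psi_a\in\mathrm{Aut}^{+}V$ such that $\psi_a(\omega)=a$. In particular, $a$ is a conformal vector.
   Context: The base field $\mathbb{K}$ is $\mathbb{R}$ or $\mathbb{C}$. For a vertex algebra $V$ over $\mathbb{K}$ with vacuum vector $\mathbf{1}$, $a(n)b$ denotes the $n$-th product ($n\in\mathbb{Z}$), $a(n)\in\mathrm{End}\,V$, and $Ta=a(-2)\mathbf{1}$. A $\mathbb{Z}$-graded vertex algebra is a vertex algebra $V=\bigoplus_{n\in\mathbb{Z}}V_n$ with $V_n(k)V_m\subset V_{n+m-k-1}$ and $\mathbf{1}\in V_0$. A $\mathbb{Z}$-graded conformal vertex algebra $(V,\omega)$ is a $\mathbb{Z}$-graded vertex algebra with a distinguished $\omega\in V_2$ such that the operators $L(n)=\omega(n+1)$ satisfy $[L(n),L(m)]=(n-m)L(n+m)+\frac{1}{12}\delta_{n+m,0}(n^3-n)c$ for some $c\in\mathbb{K}$, $L(0)v=nv$ for $v\in V_n$, and $L(-1)=T$. A vector $a\in V$ is a conformal vector if $(V,a)$, with grading $V=\bigoplus_{n\in\mathbb{Z}}V_n^a$, $V_n^a=\{v\in V\mid a(1)v=nv\}$, is a $\mathbb{Z}$-graded conformal vertex algebra. $\mathrm{pr}_n:V\to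 V_n$ is the canonical projection and $V_{\ge n}=\bigoplus_{i\ge n}V_i$. "Semisimple" means that $V$ is the direct sum of eigenspaces (with eigenvalues in $\mathbb{K}$). $\mathrm{Aut}\,V$ is the group of vertex algebra automorphisms (linear isomorphisms $f$ with $f(a(n)b)=f(a)(n)f(b)$ and $f(\mathbf{1})=\mathbf{1}$), and $\mathrm{Aut}^{+}V=\{f\in\mathrm{Aut}\,V\mid f(V_n)\subset V_{\ge n}\text{ and }\mathrm{pr}_n\circ f|_{V_n}=\mathrm{id}_{V_n}\text{ for all }n\in\mathbb{Z}\}$. *)

theory Defs
  imports Complex_Main "HOL-Library.Groups_Big_Fun"
begin

text \<open>
  The underlying vector space is the whole type \<open>'v\<close>, with scalar multiplication
  \<open>scale\<close> over \<open>'k\<close>; \<open>nprod a n b\<close> stands for $a(n)b$.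
  The base field being the reals or the complex numbers is expressed by the class
  \<^class>\<open>real_normed_field\<close>: its norm is multiplicative, so by Gelfand--Mazur its
  instances are, up to isomorphism, exactly these two fields.
\<close>

subsection \<open>Direct sums, eigenspaces, semisimplicity\<close>

definition decomposes :: "('i \<Rightarrow> 'v::ab_group_add set) \<Rightarrow> 'v \<Rightarrow> ('i \<Rightarrow> 'v) \<Rightarrow> bool" where
  "decomposes G v f \<longleftrightarrow>
     (\<forall>i. f i \<in> G i) \<and> finite {i. f i \<noteq> 0} \<and> v = (\<Sum>i | f i \<noteq> 0. f i)"

definition is_direct_sum ::
  "('k::field \<Rightarrow> 'v::ab_group_add \<Rightarrow> 'v) \<Rightarrow> ('i \<Rightarrow> 'v set) \<Rightarrow> bool" where
  "is_direct_sum scale G \<longleftrightarrow>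
     (\<forall>i. module.subspace scale (G i)) \<and> (\<forall>v. \<exists>!f. decomposes G v f)"

definition pr :: "('i \<Rightarrow> 'v::ab_group_add set) \<Rightarrow> 'i \<Rightarrow> 'v \<Rightarrow> 'v" where
  "pr G i v = (THE f. decomposes G v f) i"

definition filtration_ge ::
  "('k::field \<Rightarrow> 'v::ab_group_add \<Rightarrow> 'v) \<Rightarrow> (int \<Rightarrow> 'v set) \<Rightarrow> int \<Rightarrow> 'v set" where
  "filtration_ge scale G n = module.span scale (\<Union>i\<in>{n..}. G i)"

definition eigenspace ::
  "('k::field \<Rightarrow> 'v::ab_group_add \<Rightarrow> 'v) \<Rightarrow> ('v \<Rightarrow> 'v) \<Rightarrow> 'k \<Rightarrow> 'v set" where
  "eigenspace scale f x = {v. f v = scale x v}"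

definition is_eigenvalue ::
  "('k::field \<Rightarrow> 'v::ab_group_add \<Rightarrow> 'v) \<Rightarrow> ('v \<Rightarrow> 'v) \<Rightarrow> 'k \<Rightarrow> bool" where
  "is_eigenvalue scale f x \<longleftrightarrow> (\<exists>v. v \<noteq> 0 \<and> f v = scale x v)"

text \<open>The sum runs over all scalars; those that are not eigenvalues contribute the zero space.\<close>

definition semisimple ::
  "('k::field \<Rightarrow> 'v::ab_group_add \<Rightarrow> 'v) \<Rightarrow> ('v \<Rightarrow> 'v) \<Rightarrow> bool" where
  "semisimple scale f \<longleftrightarrow> is_direct_sum scale (eigenspace scale f)"

subsection \<open>Vertex algebras\<close>

text \<open>
  All sums in the Borcherds identity have finite support by truncation, so that
  \<^const>\<open>Sum_any\<close> (which is 0 on infinite support) is the intended sum.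
\<close>

locale vertex_algebra = vector_space scale
  for scale :: "'k::field_char_0 \<Rightarrow> 'v::ab_group_add \<Rightarrow> 'v" +
  fixes nprod :: "'v \<Rightarrow> int \<Rightarrow> 'v \<Rightarrow> 'v" and vac :: 'v
  assumes nprod_linear_left: "Vector_Spaces.linear scale scale (\<lambda>a. nprod a n b)"
    and nprod_linear_right: "Vector_Spaces.linear scale scale (\<lambda>b. nprod a n b)"
    and truncation: "\<exists>N. \<forall>n\<ge>N. nprod a n b = 0"
    and vac_left: "nprod vac n a = (if n = -1 then a else 0)"
    and vac_right_nonneg: "n \<ge> 0 \<Longrightarrow> nprod a n vac = 0"
    and vac_right_minus1: "nprod a (-1) vac = a"
    and borcherds:
      "Sum_any (\<lambda>i::nat. scale (of_int p gchoose i)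
           (nprod (nprod a (r + int i) b) (p + q - int i) c)) =
       Sum_any (\<lambda>i::nat. scale ((-1) ^ i * (of_int r gchoose i))
           (nprod a (p + r - int i) (nprod b (q + int i) c)
            - scale ((-1) powi r) (nprod b (q + r - int i) (nprod a (p + int i) c))))"

definition translation :: "('v \<Rightarrow> int \<Rightarrow> 'v \<Rightarrow> 'v) \<Rightarrow> 'v \<Rightarrow> 'v \<Rightarrow> 'v" where
  "translation nprod vac a = nprod a (-2) vac"

locale graded_vertex_algebra = vertex_algebra scale nprod vac
  for scale :: "'k::field_char_0 \<Rightarrow> 'v::ab_group_add \<Rightarrow> 'v"
    and nprod :: "'v \<Rightarrow> int \<Rightarrow> 'v \<Rightarrow> 'v" and vac :: 'v +
  fixes G :: "int \<Rightarrow> 'v set"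
  assumes grading: "is_direct_sum scale G"
    and nprod_graded: "a \<in> G n \<Longrightarrow> b \<in> G m \<Longrightarrow> nprod a k b \<in> G (n + m - k - 1)"
    and vac_graded: "vac \<in> G 0"

definition virasoro_op :: "('v \<Rightarrow> int \<Rightarrow> 'v \<Rightarrow> 'v) \<Rightarrow> 'v \<Rightarrow> int \<Rightarrow> 'v \<Rightarrow> 'v" where
  "virasoro_op nprod \<omega> n = nprod \<omega> (n + 1)"

locale conformal_vertex_algebra = graded_vertex_algebra scale nprod vac G
  for scale :: "'k::field_char_0 \<Rightarrow> 'v::ab_group_add \<Rightarrow> 'v"
    and nprod :: "'v \<Rightarrow> int \<Rightarrow> 'v \<Rightarrow> 'v" and vac :: 'v
    and G :: "int \<Rightarrow> 'v set" +
  fixes \<omega> :: 'v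
  assumes omega_graded: "\<omega> \<in> G 2"
    and virasoro: "\<exists>c. \<forall>n m v.
      virasoro_op nprod \<omega> n (virasoro_op nprod \<omega> m v)
        - virasoro_op nprod \<omega> m (virasoro_op nprod \<omega> n v) =
      scale (of_int (n - m)) (virasoro_op nprod \<omega> (n + m) v)
        + (if n + m = 0 then scale (1 / 12 * of_int (n ^ 3 - n) * c) v else 0)"
    and L0_graded: "v \<in> G n \<Longrightarrow> virasoro_op nprod \<omega> 0 v = scale (of_int n) v"
    and Lminus1: "virasoro_op nprod \<omega> (-1) = translation nprod vac"

definition conformal_vector ::
  "('k::field_char_0 \<Rightarrow> 'v::ab_group_add \<Rightarrow> 'v) \<Rightarrow> ('v \<Rightarrow> int \<Rightarrow> 'v \<Rightarrow> 'v) \<Rightarrow> 'v \<Rightarrow> 'v \<Rightarrow> bool" where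
  "conformal_vector scale nprod vac a \<longleftrightarrow>
     conformal_vertex_algebra scale nprod vac (\<lambda>n. {v. nprod a 1 v = scale (of_int n) v}) a"

subsection \<open>Automorphisms\<close>

definition va_aut ::
  "('k::field \<Rightarrow> 'v::ab_group_add \<Rightarrow> 'v) \<Rightarrow> ('v \<Rightarrow> int \<Rightarrow> 'v \<Rightarrow> 'v) \<Rightarrow> 'v \<Rightarrow> ('v \<Rightarrow> 'v) set" where
  "va_aut scale nprod vac =
     {f. Vector_Spaces.linear scale scale f \<and> bij f \<and>
         (\<forall>a n b. f (nprod a n b) = nprod (f a) n (f b)) \<and> f vac = vac}"

definition va_aut_plus ::
  "('k::field \<Rightarrow> 'v::ab_group_add \<Rightarrow> 'v) \<Rightarrow> ('v \<Rightarrow> int \<Rightarrow> 'v \<Rightarrow> 'v) \<Rightarrow> 'v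
    \<Rightarrow> (int \<Rightarrow> 'v set) \<Rightarrow> ('v \<Rightarrow> 'v) set" where
  "va_aut_plus scale nprod vac G =
     {f \<in> va_aut scale nprod vac.
        \<forall>n. f ` G n \<subseteq> filtration_ge scale G n \<and> (\<forall>v\<in>G n. pr G n (f v) = v)}"

end

theory Submission imports Defs begin

text \<open>
  Since \<open>a - \<omega>\<close> lies in $V_{\ge 3}$, the operator \<open>a(1)\<close> is \<open>L(0)\<close> plus an operator that strictly
  raises degrees.  Hence an eigenvector of \<open>a(1)\<close> with integer eigenvalue \<open>n\<close> lies in $V_{\ge n}$ and
  has a nonzero component in $V_n$ (lemma \<open>deformed_leading\<close>).  As \<open>a(1)\<close> is semisimple with integer
  eigenvalues, its eigenspaces $V_n^a$ form a second grading of \<open>V\<close>, and comparing lowest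
  components shows that $\mathrm{pr}_n$ maps $V_n^a$ bijectively onto $V_n$.  Together these bijections form a linear
  bijection \<open>\<phi>\<close> of \<open>V\<close> (\<open>lead\<close> in locale \<open>leading_gradings\<close>).

  The hypothesis \<open>a(0) = T\<close> and Borcherds' identity give
  $[a(1), u(k)] = (a(1)u)(k) - (k+1)\,u(k)$, so the $V_n^a$ are a grading of the vertex
  algebra: $V_n^a(k)V_m^a \subset V_{n+m-k-1}^a$.  The component in $V_{n+m-k-1}$ of a product \<open>u(k)v\<close>
  with $u \in V_{\ge n}$ and $v \in V_{\ge m}$ is the product of the components of \<open>u\<close> in $V_n$ and of \<open>v\<close>
  in $V_m$; therefore \<open>\<phi>\<close> preserves all products.  It sends \<open>a\<close>, which is in $V_2^a$, to $\mathrm{pr}_2(a) = \omega$,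
  and \<open>\<phi>\<^sup>-\<^sup>1\<close> is the required automorphism.

  For uniqueness, an automorphism \<open>f\<close> with \<open>f \<omega> = a\<close> intertwines \<open>\<omega>(1)\<close> and \<open>a(1)\<close>, so it maps $V_n$ into
  $V_n^a$; if moreover $\mathrm{pr}_n \circ f$ is the identity on $V_n$, then \<open>\<phi> \<circ> f\<close> is the identity.  Finally, the image of a
  conformal vector under an automorphism is a conformal vector.
\<close>

section \<open>Direct sum decompositions\<close>

text \<open>A vector space with a chosen decomposition into subspaces \<open>G i\<close>; \<^term>\<open>pr G i\<close> is the \<open>i\<close>-th projection.\<close>

locale direct_sum = vector_space scale
  for scale :: "'k::field \<Rightarrow> 'v::ab_group_add \<Rightarrow> 'v" +
  fixes G :: "'i \<Rightarrow> 'v set"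
  assumes is_direct_sum: "is_direct_sum scale G"
begin

lemma subspace_G: "subspace (G i)"
  using is_direct_sum by (simp add: is_direct_sum_def)

lemma zero_in_G [simp]: "0 \<in> G i"
  by (rule subspace_0[OF subspace_G])

lemma decomposes_pr: "decomposes G v (\<lambda>i. pr G i v)"
proof -
  have "\<exists>!f. decomposes G v f"
    using is_direct_sum by (simp add: is_direct_sum_def)
  from theI'[OF this] show ?thesis
    by (simp add: pr_def)
qed

lemma pr_eqI: "decomposes G v f \<Longrightarrow> pr G i v = f i"
proof -
  assume f: "decomposes G v f"
  have "\<exists>!f. decomposes G v f"
    using is_direct_sum by (simp add: is_direct_sum_def)
  with f have "(THE f. decomposes G v f) = f"
    by (rule the1_equality[rotated])
  then show ?thesis
    by (simp add: pr_def)
qed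

lemma pr_in [simp]: "pr G i v \<in> G i"
  using decomposes_pr by (simp add: decomposes_def)

lemma finite_pr_support [simp]: "finite {i. pr G i v \<noteq> 0}"
  using decomposes_pr by (simp add: decomposes_def)

lemma sum_pr_support: "(\<Sum>i | pr G i v \<noteq> 0. pr G i v) = v"
  using decomposes_pr[of v] by (simp add: decomposes_def)

lemma sum_pr:
  assumes "finite S" and "{i. pr G i v \<noteq> 0} \<subseteq> S"
  shows "(\<Sum>i\<in>S. pr G i v) = v"
proof -
  have "(\<Sum>i\<in>S. pr G i v) = (\<Sum>i | pr G i v \<noteq> 0. pr G i v)"
    by (rule sum.mono_neutral_right) (use assms in auto)
  then show ?thesis by (simp add: sum_pr_support)
qed

lemma pr_sum_eq:
  assumes "\<And>i. f i \<in> G i" and "finite S" and "\<And>i. f i \<noteq> 0 \<Longrightarrow> i \<in> S"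
  shows "pr G i (sum f S) = f i"
proof (rule pr_eqI)
  have sub: "{i. f i \<noteq> 0} \<subseteq> S" using assms(3) by blast
  have "sum f S = (\<Sum>i | f i \<noteq> 0. f i)"
    by (rule sum.mono_neutral_right) (use assms in auto)
  then show "decomposes G (sum f S) f"
    using assms(1) finite_subset[OF sub assms(2)] by (simp add: decomposes_def)
qed

lemma pr_add [simp]: "pr G i (v + w) = pr G i v + pr G i w"
proof -
  let ?S = "{i. pr G i v \<noteq> 0} \<union> {i. pr G i w \<noteq> 0}"
  have "pr G i (\<Sum>i\<in>?S. pr G i v + pr G i w) = pr G i v + pr G i w"
    by (rule pr_sum_eq) (auto intro: subspace_add[OF subspace_G])
  moreover have "(\<Sum>i\<in>?S. pr G i v + pr G i w) = v + w"
    by (simp add: sum.distrib sum_pr)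
  ultimately show ?thesis by simp
qed

lemma pr_scale [simp]: "pr G i (scale c v) = scale c (pr G i v)"
proof -
  let ?S = "{i. pr G i v \<noteq> 0}"
  have "pr G i (\<Sum>i\<in>?S. scale c (pr G i v)) = scale c (pr G i v)"
    by (rule pr_sum_eq) (auto intro: subspace_scale[OF subspace_G])
  moreover have "(\<Sum>i\<in>?S. scale c (pr G i v)) = scale c v"
    by (simp add: scale_sum_right[symmetric] sum_pr)
  ultimately show ?thesis by simp
qed

lemma pr_homogeneous:
  assumes "v \<in> G n"
  shows "pr G i v = (if i = n then v else 0)"
proof -
  have "pr G i (\<Sum>i\<in>{n}. if i = n then v else 0) = (if i = n then v else 0)"
    by (rule pr_sum_eq) (use assms in \<open>auto split: if_splits\<close>)
  then show ?thesis by simp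
qed

lemma linear_pr: "Vector_Spaces.linear scale scale (pr G i)"
  by (simp add: Vector_Spaces.linear_iff vector_space_axioms)

lemma pr_zero [simp]: "pr G i 0 = 0"
  by (simp add: pr_homogeneous[OF zero_in_G[of i]])

lemma pr_eq_zeroD: "(\<And>i. pr G i v = 0) \<Longrightarrow> v = 0"
  using sum_pr_support[of v] by simp

lemma pr_eqD:
  assumes "\<And>i. pr G i v = pr G i w"
  shows "v = w"
proof -
  have "v = (\<Sum>i | pr G i v \<noteq> 0. pr G i v)"
    by (rule sum_pr_support[symmetric])
  also have "\<dots> = (\<Sum>i | pr G i w \<noteq> 0. pr G i w)"
    by (simp add: assms)
  also have "\<dots> = w"
    by (rule sum_pr_support)
  finally show ?thesis .
qed

lemma homogeneous_induct [case_names homogeneous add]: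
  assumes hom: "\<And>n x. x \<in> G n \<Longrightarrow> P x"
    and add: "\<And>x y. P x \<Longrightarrow> P y \<Longrightarrow> P (x + y)"
  shows "P v"
proof -
  have "P (\<Sum>i\<in>S. pr G i v)" if "finite S" for S
    using that
  proof (induction S)
    case empty
    show ?case using hom[OF zero_in_G] by simp
  next
    case (insert i S)
    then show ?case using add[OF hom[OF pr_in]] by simp
  qed
  from this[OF finite_pr_support[of v]] show ?thesis
    by (simp only: sum_pr_support)
qed

end

lemma (in vector_space) direct_sum_bij_image:
  assumes "direct_sum scale G"
    and lin: "Vector_Spaces.linear scale scale f" and bij: "bij f"
  shows "direct_sum scale (\<lambda>i. f ` G i)"
proof unfold_locales
  interpret G: direct_sum scale G by fact
  interpret f: Vector_Spaces.linear scale scale f by fact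
  have inj: "inj f" using bij by (rule bij_is_inj)
  have f0 [simp]: "f x = 0 \<longleftrightarrow> x = 0" for x
    using inj f.zero by (metis injD)
  have dec: "decomposes (\<lambda>i. f ` G i) (f v) (\<lambda>i. f (h i)) \<longleftrightarrow> decomposes G v h" for v h
  proof -
    have "f v = (\<Sum>i | h i \<noteq> 0. f (h i)) \<longleftrightarrow> v = (\<Sum>i | h i \<noteq> 0. h i)"
      by (simp only: f.sum[symmetric] inj_eq[OF inj])
    then show ?thesis
      by (simp only: decomposes_def inj_image_mem_iff[OF inj] f0)
  qed
  show "is_direct_sum scale (\<lambda>i. f ` G i)"
    unfolding is_direct_sum_def
  proof (intro conjI allI)
    show "subspace (f ` G i)" for i
      by (rule f.subspace_image[OF G.subspace_G])
    fix w
    obtain v where w: "w = f v" using bij by (metis bij_pointE)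
    show "\<exists>!h. decomposes (\<lambda>i. f ` G i) w h"
    proof
      show "decomposes (\<lambda>i. f ` G i) w (\<lambda>i. f (pr G i v))"
        unfolding w dec by (rule G.decomposes_pr)
      fix h assume h: "decomposes (\<lambda>i. f ` G i) w h"
      define h' where "h' = inv f \<circ> h"
      have hh': "h = (\<lambda>i. f (h' i))"
        using bij by (auto simp: h'_def bij_is_surj surj_f_inv_f)
      have "decomposes G v h'" using h unfolding hh' w dec .
      then show "h = (\<lambda>i. f (pr G i v))"
        unfolding hh' by (simp add: G.pr_eqI)
    qed
  qed
qed

text \<open>Zero summands may be left out of a direct sum.\<close>

lemma (in direct_sum) direct_sum_reindex:
  assumes inj: "inj h" and zero: "\<And>i. i \<notin> range h \<Longrightarrow> G i = {0}"
  shows "direct_sum scale (\<lambda>j. G (h j))"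
proof unfold_locales
  show "is_direct_sum scale (\<lambda>j. G (h j))"
    unfolding is_direct_sum_def
  proof (intro conjI allI)
    show "subspace (G (h j))" for j by (rule subspace_G)
    fix v
    have supp: "{i. f i \<noteq> 0} = h ` {j. f (h j) \<noteq> 0}" if "\<And>i. f i \<in> G i" for f
    proof -
      have "i \<in> range h" if "f i \<noteq> 0" for i
        using zero[of i] that \<open>f i \<in> G i\<close> by blast
      then show ?thesis by blast
    qed
    have dec: "decomposes (\<lambda>j. G (h j)) v (\<lambda>j. f (h j))" if f: "decomposes G v f" for f
    proof -
      have S: "{i. f i \<noteq> 0} = h ` {j. f (h j) \<noteq> 0}"
        using supp f by (simp add: decomposes_def)
      have "v = (\<Sum>i\<in>h ` {j. f (h j) \<noteq> 0}. f i)"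
        using f unfolding decomposes_def S by simp
      also have "\<dots> = (\<Sum>j | f (h j) \<noteq> 0. f (h j))"
        by (rule sum.reindex_cong[OF inj_on_subset[OF inj subset_UNIV] refl refl])
      finally show ?thesis
        using f S finite_imageD[OF _ inj_on_subset[OF inj subset_UNIV]]
        by (auto simp: decomposes_def)
    qed
    show "\<exists>!f. decomposes (\<lambda>j. G (h j)) v f"
    proof
      show "decomposes (\<lambda>j. G (h j)) v (\<lambda>j. pr G (h j) v)"
        by (rule dec[OF decomposes_pr])
      fix g assume g: "decomposes (\<lambda>j. G (h j)) v g"
      define f where "f i = (if i \<in> range h then g (inv h i) else 0)" for i
      have fh: "f (h j) = g j" for j by (simp add: f_def inj)
      have f_in: "f i \<in> G i" for i
        using g inj by (auto simp: f_def decomposes_def)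
      have S: "{i. f i \<noteq> 0} = h ` {j. g j \<noteq> 0}"
        using supp[of f] f_in by (simp add: fh)
      have "(\<Sum>i\<in>h ` {j. g j \<noteq> 0}. f i) = (\<Sum>j | g j \<noteq> 0. g j)"
        by (rule sum.reindex_cong[OF inj_on_subset[OF inj subset_UNIV] refl]) (simp add: fh)
      then have "decomposes G v f"
        using g f_in unfolding decomposes_def S by simp
      from pr_eqI[OF this] show "g = (\<lambda>j. pr G (h j) v)"
        by (simp add: fh)
    qed
  qed
qed

lemma semisimple_integer_direct_sum:
  fixes scale :: "'k::field_char_0 \<Rightarrow> 'v::ab_group_add \<Rightarrow> 'v"
  assumes "vector_space scale" and ss: "semisimple scale f"
    and int: "\<forall>x. is_eigenvalue scale f x \<longrightarrow> x \<in> \<int>"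
  shows "direct_sum scale (\<lambda>n::int. {v. f v = scale (of_int n) v})"
proof -
  interpret vector_space scale by fact
  interpret direct_sum scale "eigenspace scale f"
    by unfold_locales (use ss in \<open>simp add: semisimple_def\<close>)
  have "direct_sum scale (\<lambda>n::int. eigenspace scale f (of_int n))"
  proof (rule direct_sum_reindex)
    show "inj (of_int :: int \<Rightarrow> 'k)" by (rule injI) simp
    fix x :: 'k assume "x \<notin> range of_int"
    then have "\<not> is_eigenvalue scale f x" using int by (auto simp: Ints_def)
    then show "eigenspace scale f x = {0}"
      using zero_in_G[of x] by (auto simp: is_eigenvalue_def eigenspace_def)
  qed
  then show ?thesis by (simp add: eigenspace_def)
qed

section \<open>Integer gradings and leading components\<close>

locale int_graded_space = direct_sum scale G
  for scale :: "'k::field \<Rightarrow> 'v::ab_group_add \<Rightarrow> 'v" and G :: "int \<Rightarrow> 'v set"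
begin

lemma subspace_filtration: "subspace (filtration_ge scale G n)"
  by (simp add: filtration_ge_def subspace_span)

lemma G_subset_filtration: "n \<le> i \<Longrightarrow> G i \<subseteq> filtration_ge scale G n"
  unfolding filtration_ge_def by (rule order_trans[OF _ span_superset]) auto

lemma filtration_ge_iff: "v \<in> filtration_ge scale G n \<longleftrightarrow> (\<forall>i<n. pr G i v = 0)"
proof
  assume "v \<in> filtration_ge scale G n"
  then show "\<forall>i<n. pr G i v = 0"
    unfolding filtration_ge_def
  proof (induction v rule: span_induct)
    case base
    show ?case by (simp add: subspace_def)
  next
    case (step x)
    then show ?case by (auto simp: pr_homogeneous)
  qed
next
  assume *: "\<forall>i<n. pr G i v = 0"
  have "(\<Sum>i | pr G i v \<noteq> 0. pr G i v) \<in> filtration_ge scale G n"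
  proof (rule subspace_sum[OF subspace_filtration])
    fix i assume "i \<in> {i. pr G i v \<noteq> 0}"
    then have "n \<le> i" using * by force
    then show "pr G i v \<in> filtration_ge scale G n"
      using G_subset_filtration pr_in by blast
  qed
  then show "v \<in> filtration_ge scale G n" by (simp only: sum_pr_support)
qed

text \<open>A nonzero vector has a lowest nonzero component.\<close>

lemma leading_component:
  assumes "v \<noteq> 0"
  obtains m where "pr G m v \<noteq> 0" and "v \<in> filtration_ge scale G m"
proof -
  let ?S = "{i. pr G i v \<noteq> 0}"
  have ne: "?S \<noteq> {}" using assms pr_eq_zeroD by blast
  have "Min ?S \<in> ?S" by (rule Min_in) (use ne in simp_all)
  moreover have "v \<in> filtration_ge scale G (Min ?S)"
    unfolding filtration_ge_iff by (metis (mono_tags, lifting) Min_le finite_pr_support mem_Collect_eq not_le)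
  ultimately show ?thesis using that by blast
qed

end

text \<open>
  Two gradings \<open>G\<close> and \<open>H\<close> of the same space, where a nonzero element of \<open>H n\<close> has its lowest
  \<open>G\<close>-component in degree \<open>n\<close>.
\<close>

locale leading_gradings =
  G: int_graded_space scale G + H: int_graded_space scale H
  for scale :: "'k::field \<Rightarrow> 'v::ab_group_add \<Rightarrow> 'v" and G H :: "int \<Rightarrow> 'v set" +
  assumes H_filtration: "H n \<subseteq> filtration_ge scale G n"
    and H_leading: "u \<in> H n \<Longrightarrow> pr G n u = 0 \<Longrightarrow> u = 0"
begin

text \<open>The projection to degree \<open>n\<close> maps \<open>H n\<close> onto \<open>G n\<close>, with the \<open>H\<close>-projection as a right inverse.\<close>

lemma pr_surj:
  assumes "x \<in> G n"
  shows "pr G n (pr H n x) = x"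
proof (cases "x = 0")
  case False
  then obtain m where m: "pr H m x \<noteq> 0" "x \<in> filtration_ge scale H m"
    by (rule H.leading_component)
  interpret prm: Vector_Spaces.linear scale scale "pr G m" by (rule G.linear_pr)
  \<comment> \<open>Only the lowest \<open>H\<close>-component of \<open>x\<close> contributes to the degree \<open>m\<close> part of \<open>x\<close>.\<close>
  have "pr G m (pr H k x) = 0" if "k \<noteq> m" for k
  proof (cases "k < m")
    case True
    then show ?thesis using m(2) by (simp add: H.filtration_ge_iff)
  next
    case False
    then have "m < k" using that by simp
    then show ?thesis
      using subsetD[OF H_filtration H.pr_in[of k x]] by (simp add: G.filtration_ge_iff)
  qed
  then have "(\<Sum>k | pr H k x \<noteq> 0. pr G m (pr H k x)) = (\<Sum>k\<in>{m}. pr G m (pr H k x))"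
    using m(1) by (intro sum.mono_neutral_right) auto
  then have m_part: "pr G m x = pr G m (pr H m x)"
    by (simp add: prm.sum[symmetric] H.sum_pr_support)
  moreover have "pr G m (pr H m x) \<noteq> 0"
    using m(1) H_leading[OF H.pr_in] by blast
  ultimately have "m = n"
    using G.pr_homogeneous[OF assms, of m] by (auto split: if_splits)
  then show ?thesis
    using m_part G.pr_homogeneous[OF assms, of n] by simp
qed simp

text \<open>The linear map that agrees with $\mathrm{pr}_n$ (with respect to \<open>G\<close>) on each \<open>H n\<close>.\<close>

definition lead :: "'v \<Rightarrow> 'v" where
  "lead v = (\<Sum>n | pr H n v \<noteq> 0. pr G n (pr H n v))"

lemma pr_lead: "pr G n (lead v) = pr G n (pr H n v)"
  unfolding lead_def by (rule G.pr_sum_eq) (simp_all, metis G.pr_zero)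

lemma lead_homogeneous: "u \<in> H n \<Longrightarrow> lead u = pr G n u"
  by (rule G.pr_eqD) (auto simp: pr_lead H.pr_homogeneous G.pr_homogeneous[OF G.pr_in])

lemma lead_pr_H: "x \<in> G n \<Longrightarrow> lead (pr H n x) = x"
  using lead_homogeneous[OF H.pr_in] pr_surj by simp

lemma lead_add: "lead (v + w) = lead v + lead w"
  by (rule G.pr_eqD) (simp add: pr_lead)

lemma linear_lead: "Vector_Spaces.linear scale scale lead"
  unfolding Vector_Spaces.linear_iff
proof (intro conjI allI G.vector_space_axioms lead_add)
  show "lead (scale c v) = scale c (lead v)" for c v
    by (rule G.pr_eqD) (simp add: pr_lead)
qed

lemma bij_lead: "bij lead"
proof (rule bijI)
  interpret l: Vector_Spaces.linear scale scale lead by (rule linear_lead)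
  have "v = 0" if "lead v = 0" for v
  proof (rule H.pr_eq_zeroD)
    fix n
    have "pr G n (pr H n v) = 0" using pr_lead[of n v] that by simp
    then show "pr H n v = 0" by (rule H_leading[OF H.pr_in])
  qed
  then show "inj lead" by (simp add: l.inj_iff_eq_0)
  have "v \<in> range lead" for v
  proof (induction v rule: G.homogeneous_induct)
    case (homogeneous n x)
    then show ?case by (metis lead_pr_H rangeI)
  next
    case (add x y)
    then obtain v w where "x = lead v" "y = lead w" by blast
    then have "x + y = lead (v + w)" by (simp add: lead_add)
    then show ?case by blast
  qed
  then show "surj lead" by blast
qed

end

section \<open>Vertex algebra identities\<close>

lemma gbinomial_minus_2: "(-1) ^ i * ((-2 :: 'a::field_char_0) gchoose i) = of_nat (Suc i)"
proof -
  have "((-2 :: 'a) gchoose i) = (-1) ^ i * (of_nat (Suc i) gchoose i)"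
    using gbinomial_minus[of "2::'a" i] by (simp add: algebra_simps)
  then show ?thesis
    by (simp add: binomial_gbinomial[symmetric] power_mult_distrib[symmetric] del: of_nat_Suc
        flip: mult.assoc)
qed

context vertex_algebra
begin

lemma nprod_add_left [simp]: "nprod (a + a') n b = nprod a n b + nprod a' n b"
  using nprod_linear_left[of n b] by (simp add: Vector_Spaces.linear_iff)

lemma nprod_scale_left [simp]: "nprod (scale c a) n b = scale c (nprod a n b)"
  using nprod_linear_left[of n b] by (simp add: Vector_Spaces.linear_iff)

lemma nprod_add_right [simp]: "nprod a n (b + b') = nprod a n b + nprod a n b'"
  using nprod_linear_right[of a n] by (simp add: Vector_Spaces.linear_iff)

lemma nprod_scale_right [simp]: "nprod a n (scale c b) = scale c (nprod a n b)"
  using nprod_linear_right[of a n] by (simp add: Vector_Spaces.linear_iff)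

lemma nprod_zero_left [simp]: "nprod 0 n b = 0"
  using nprod_scale_left[of 0 0 n b] by simp

lemma nprod_zero_right [simp]: "nprod a n 0 = 0"
  using nprod_scale_right[of a n 0 0] by simp

text \<open>The commutator formula for \<open>a(1)\<close>: Borcherds' identity with \<open>p = 1\<close> and \<open>r = 0\<close>.\<close>

lemma commutator_1:
  "nprod a 1 (nprod b q c) - nprod b q (nprod a 1 c) =
     nprod (nprod a 0 b) (q + 1) c + nprod (nprod a 1 b) q c"
proof -
  let ?L = "\<lambda>i::nat. scale (of_int 1 gchoose i)
           (nprod (nprod a (0 + int i) b) (1 + q - int i) c)"
  let ?R = "\<lambda>i::nat. scale ((-1) ^ i * (of_int 0 gchoose i))
           (nprod a (1 + 0 - int i) (nprod b (q + int i) c)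
            - scale ((-1) powi 0) (nprod b (q + 0 - int i) (nprod a (1 + int i) c)))"
  have c1: "((1::'k) gchoose i) = 0" if "i \<noteq> 0" "i \<noteq> 1" for i
    using that binomial_gbinomial[of 1 i, where 'a = 'k, symmetric] by (simp add: binomial_eq_0)
  have "Sum_any ?L = sum ?L {0, 1}"
    by (rule Sum_any.expand_superset) (use c1 in auto)
  moreover have c0: "((0::'k) gchoose i) = 0" if "i \<noteq> 0" for i
    using that by (cases i) simp_all
  have "Sum_any ?R = sum ?R {0}"
    by (rule Sum_any.expand_superset) (use c0 in auto)
  ultimately show ?thesis
    using borcherds[of 1 a 0 b q c] by (simp add: add.commute)
qed

text \<open>
  Borcherds' identity for \<open>b\<close> and the vacuum with \<open>p = 0\<close> and \<open>r = -2\<close>: the vacuum products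
  \<open>vac(j)\<close> vanish unless \<open>j = -1\<close>, so on the right only the term with index \<open>\<bar>q\<bar> - 1\<close> can survive.
\<close>

lemma translation_nprod:
  "nprod (translation nprod vac b) q c = scale (- of_int q) (nprod b (q - 1) c)"
proof -
  let ?L = "\<lambda>i::nat. scale (of_int 0 gchoose i)
           (nprod (nprod b (-2 + int i) vac) (0 + q - int i) c)"
  let ?R = "\<lambda>i::nat. scale ((-1) ^ i * (of_int (-2) gchoose i))
           (nprod b (0 + (-2) - int i) (nprod vac (q + int i) c)
            - scale ((-1) powi (-2)) (nprod vac (q + (-2) - int i) (nprod b (0 + int i) c)))"
  have c0: "((0::'k) gchoose i) = 0" if "i \<noteq> 0" for i
    using that by (cases i) simp_all
  have L: "Sum_any ?L = sum ?L {0}"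
    by (rule Sum_any.expand_superset) (use c0 in auto)
  have R: "Sum_any ?R = sum ?R {nat (\<bar>q\<bar> - 1)}"
    by (rule Sum_any.expand_superset) (auto simp: vac_left split: if_splits)
  have "sum ?R {nat (\<bar>q\<bar> - 1)} = scale (- of_int q) (nprod b (q - 1) c)"
  proof -
    consider "q = 0" | "q > 0" | "q < 0" by linarith
    then show ?thesis
    proof cases
      case 1
      then show ?thesis by (simp add: vac_left)
    next
      case 2
      then obtain i where q: "q = int i + 1"
        using zero_less_imp_eq_int[of q] by (metis add.commute gr0_implies_Suc of_nat_Suc of_nat_0_less_iff)
      then show ?thesis
        using gbinomial_minus_2[of i, where 'a = 'k]
        by (simp add: q vac_left scale_minus_left[symmetric] del: scale_minus_left)
    next
      case 3
      then obtain i where q: "q = - 1 - int i"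
        using negD[of q] by fastforce
      then show ?thesis
        using gbinomial_minus_2[of i, where 'a = 'k]
        by (simp add: q vac_left scale_left_distrib diff_diff_eq)
    qed
  qed
  then show ?thesis
    using borcherds[of 0 b "-2" vac q c] L R by (simp add: translation_def)
qed

end

section \<open>Conformal vertex algebras\<close>

sublocale graded_vertex_algebra \<subseteq> int_graded_space scale G
  by unfold_locales (rule grading)

context graded_vertex_algebra
begin

lemma nprod_filtration:
  assumes "x \<in> filtration_ge scale G i" and "y \<in> filtration_ge scale G j"
  shows "nprod x k y \<in> filtration_ge scale G (i + j - k - 1)"
proof -
  let ?F = "filtration_ge scale G (i + j - k - 1)"
  have sub: "subspace ?F" by (rule subspace_filtration)
  have 1: "nprod u k y \<in> ?F" if u: "u \<in> G n" "i \<le> n" for u n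
    using assms(2) unfolding filtration_ge_def[of scale G j]
  proof (induction y rule: span_induct)
    case base
    show ?case
      using subspace_0[OF sub] subspace_add[OF sub] subspace_scale[OF sub]
      by (simp add: subspace_def)
  next
    case (step w)
    then obtain m where m: "w \<in> G m" "j \<le> m" by auto
    have "G (n + m - k - 1) \<subseteq> ?F"
      by (rule G_subset_filtration) (use m u in simp)
    then show ?case using nprod_graded[OF u(1) m(1), of k] by blast
  qed
  show ?thesis
    using assms(1) unfolding filtration_ge_def[of scale G i]
  proof (induction x rule: span_induct)
    case base
    show ?case
      using subspace_0[OF sub] subspace_add[OF sub] subspace_scale[OF sub]
      by (simp add: subspace_def)
  next
    case (step u)
    then show ?case using 1 by auto
  qed
qed

text \<open>The leading component of a product is the product of the leading components.\<close>

lemma pr_nprod: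
  assumes x: "x \<in> filtration_ge scale G i" and y: "y \<in> filtration_ge scale G j"
  shows "pr G (i + j - k - 1) (nprod x k y) = nprod (pr G i x) k (pr G j y)"
proof -
  have split: "\<exists>x'. x = pr G i x + x' \<and> x' \<in> filtration_ge scale G (i + 1)"
    if "x \<in> filtration_ge scale G i" for x i
  proof (intro exI conjI)
    let ?x' = "x + scale (-1) (pr G i x)"
    show "x = pr G i x + ?x'" by simp
    show "?x' \<in> filtration_ge scale G (i + 1)"
      unfolding filtration_ge_iff
    proof (intro allI impI)
      fix l assume "l < i + 1"
      then show "pr G l ?x' = 0"
        using that pr_homogeneous[OF pr_in, of l i x]
        by (cases "l = i") (simp_all only: pr_add pr_scale filtration_ge_iff, auto)
    qed
  qed
  let ?n = "i + j - k - 1"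
  obtain x' where x': "x = pr G i x + x'" "x' \<in> filtration_ge scale G (i + 1)"
    using split[OF x] by blast
  obtain y' where y': "y = pr G j y + y'" "y' \<in> filtration_ge scale G (j + 1)"
    using split[OF y] by blast
  have px: "pr G i x \<in> filtration_ge scale G i"
    using G_subset_filtration[of i i] pr_in by blast
  have "nprod x k y = nprod (pr G i x) k (pr G j y + y') + nprod x' k y"
    using x'(1) y'(1) by (metis nprod_add_left)
  also have "\<dots> = nprod (pr G i x) k (pr G j y) + (nprod (pr G i x) k y' + nprod x' k y)"
    by (simp add: add.assoc)
  finally have eq: "nprod x k y = \<dots>" .
  have "pr G ?n (nprod (pr G i x) k y') = 0"
    using nprod_filtration[OF px y'(2), of k] by (simp add: filtration_ge_iff)
  moreover have "pr G ?n (nprod x' k y) = 0"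
    using nprod_filtration[OF x'(2) y, of k] by (simp add: filtration_ge_iff)
  moreover have "pr G ?n (nprod (pr G i x) k (pr G j y)) = nprod (pr G i x) k (pr G j y)"
    using pr_homogeneous[OF nprod_graded[OF pr_in pr_in]] by simp
  ultimately show ?thesis unfolding eq by simp
qed

end

context conformal_vertex_algebra
begin

lemma omega_1: "v \<in> G n \<Longrightarrow> nprod \<omega> 1 v = scale (of_int n) v"
  using L0_graded[of v n] by (simp add: virasoro_op_def)

lemma G_eq_eigenspace: "G n = {v. nprod \<omega> 1 v = scale (of_int n) v}"
proof (intro equalityI subsetI)
  fix v assume "v \<in> {v. nprod \<omega> 1 v = scale (of_int n) v}"
  then have v: "nprod \<omega> 1 v = scale (of_int n) v" by simp
  have diag: "pr G i (nprod \<omega> 1 w) = scale (of_int i) (pr G i w)" for i w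
  proof (induction w rule: homogeneous_induct)
    case (homogeneous m x)
    then show ?case by (simp add: omega_1 pr_homogeneous)
  next
    case (add x y)
    then show ?case by (simp add: scale_right_distrib)
  qed
  have "pr G i v = 0" if "i \<noteq> n" for i
    using diag[of i v] v that by (simp add: scale_cancel_right)
  then have "pr G i v = pr G i (pr G n v)" for i
    using pr_homogeneous[OF pr_in, of i n v] by auto
  then have "v = pr G n v" by (rule pr_eqD)
  then show "v \<in> G n" using pr_in by metis
qed (simp add: omega_1)

text \<open>
  All the structure is transported along \<open>f\<close>.  The grading required by \<^const>\<open>conformal_vector\<close>,
  by eigenspaces of \<open>(f \<omega>)(1)\<close>, is the image of \<open>G\<close> because \<open>G n\<close> is the whole \<open>n\<close>-eigenspace of \<open>\<omega>(1)\<close>.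
\<close>

lemma conformal_vector_automorphism:
  assumes "f \<in> va_aut scale nprod vac"
  shows "conformal_vector scale nprod vac (f \<omega>)"
proof -
  have lin: "Vector_Spaces.linear scale scale f" and bij: "bij f"
    and mult: "\<And>a n b. f (nprod a n b) = nprod (f a) n (f b)" and vac: "f vac = vac"
    using assms by (auto simp: va_aut_def)
  interpret f: Vector_Spaces.linear scale scale f by (rule lin)
  have inj: "inj f" using bij by (rule bij_is_inj)
  have eig: "{v. nprod (f \<omega>) 1 v = scale (of_int n) v} = f ` G n" for n
  proof (intro equalityI subsetI)
    fix w assume "w \<in> {v. nprod (f \<omega>) 1 v = scale (of_int n) v}"
    moreover obtain v where w: "w = f v" using bij by (metis bij_pointE)
    ultimately have "f (nprod \<omega> 1 v) = f (scale (of_int n) v)"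
      by (simp add: mult f.scale)
    then have "v \<in> G n" unfolding G_eq_eigenspace using inj by (simp add: inj_eq)
    then show "w \<in> f ` G n" using w by blast
  next
    fix w assume "w \<in> f ` G n"
    then show "w \<in> {v. nprod (f \<omega>) 1 v = scale (of_int n) v}"
      by (auto simp: mult[symmetric] omega_1 f.scale)
  qed
  have vop: "virasoro_op nprod (f \<omega>) n (f v) = f (virasoro_op nprod \<omega> n v)" for n v
    by (simp add: virasoro_op_def mult)
  have tr: "translation nprod vac (f v) = f (translation nprod vac v)" for v
    by (simp add: translation_def mult vac)
  have "direct_sum scale (\<lambda>n. f ` G n)"
    by (rule direct_sum_bij_image[OF _ lin bij]) unfold_locales
  then interpret D: direct_sum scale "\<lambda>n. f ` G n" .
  obtain c where c: "\<And>n m v.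
      virasoro_op nprod \<omega> n (virasoro_op nprod \<omega> m v)
        - virasoro_op nprod \<omega> m (virasoro_op nprod \<omega> n v) =
      scale (of_int (n - m)) (virasoro_op nprod \<omega> (n + m) v)
        + (if n + m = 0 then scale (1 / 12 * of_int (n ^ 3 - n) * c) v else 0)"
    using virasoro by blast
  have "conformal_vertex_algebra scale nprod vac (\<lambda>n. f ` G n) (f \<omega>)"
  proof unfold_locales
    show "is_direct_sum scale (\<lambda>n. f ` G n)" by (rule D.is_direct_sum)
    show "nprod a k b \<in> f ` G (n + m - k - 1)" if "a \<in> f ` G n" "b \<in> f ` G m" for a b n m k
      using that nprod_graded by (auto simp: mult[symmetric])
    show "vac \<in> f ` G 0" using vac vac_graded by (metis imageI)
    show "f \<omega> \<in> f ` G 2" using omega_graded by simp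
    show "virasoro_op nprod (f \<omega>) 0 v = scale (of_int n) v" if "v \<in> f ` G n" for v n
      using that by (auto simp: vop L0_graded f.scale)
    show "virasoro_op nprod (f \<omega>) (-1) = translation nprod vac"
    proof
      fix w
      obtain v where "w = f v" using bij by (metis bij_pointE)
      then show "virasoro_op nprod (f \<omega>) (-1) w = translation nprod vac w"
        by (simp add: vop tr Lminus1)
    qed
    show "\<exists>c. \<forall>n m v.
      virasoro_op nprod (f \<omega>) n (virasoro_op nprod (f \<omega>) m v)
        - virasoro_op nprod (f \<omega>) m (virasoro_op nprod (f \<omega>) n v) =
      scale (of_int (n - m)) (virasoro_op nprod (f \<omega>) (n + m) v)
        + (if n + m = 0 then scale (1 / 12 * of_int (n ^ 3 - n) * c) v else 0)"
    proof (intro exI allI)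
      fix n m w
      obtain v where "w = f v" using bij by (metis bij_pointE)
      then show "virasoro_op nprod (f \<omega>) n (virasoro_op nprod (f \<omega>) m w)
          - virasoro_op nprod (f \<omega>) m (virasoro_op nprod (f \<omega>) n w) =
        scale (of_int (n - m)) (virasoro_op nprod (f \<omega>) (n + m) w)
          + (if n + m = 0 then scale (1 / 12 * of_int (n ^ 3 - n) * c) w else 0)"
        using arg_cong[OF c[of n m v], of f]
        by (cases "n + m = 0") (simp_all only: vop f.diff f.add f.scale f.zero refl if_True if_False)
    qed
  qed
  then show ?thesis unfolding conformal_vector_def eig .
qed

end

section \<open>The grading defined by the deformed conformal vector\<close>

text \<open>
  A vector \<open>a\<close> with lowest component \<open>\<omega>\<close> that shares with a conformal vector the translation
  operator and the integral semisimple action of its degree operator \<open>a(1)\<close>; the Virasoro relations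
  are not assumed.
\<close>

locale deformed_conformal = conformal_vertex_algebra scale nprod vac G \<omega>
  for scale :: "'k::field_char_0 \<Rightarrow> 'v::ab_group_add \<Rightarrow> 'v"
    and nprod :: "'v \<Rightarrow> int \<Rightarrow> 'v \<Rightarrow> 'v" and vac :: 'v
    and G :: "int \<Rightarrow> 'v set" and \<omega> :: 'v +
  fixes a :: 'v
  assumes a_filtration: "a \<in> filtration_ge scale G 2"
    and pr_a: "pr G 2 a = \<omega>"
    and a_0: "nprod a 0 = translation nprod vac"
    and a_1_a: "nprod a 1 a = scale 2 a"
    and a_1_semisimple: "semisimple scale (nprod a 1)"
    and a_1_eigenvalues: "\<forall>x. is_eigenvalue scale (nprod a 1) x \<longrightarrow> x \<in> \<int>"
begin

text \<open>The eigenspace $V_n^a$ of \<open>a(1)\<close>.\<close>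

definition Ga :: "int \<Rightarrow> 'v set" where
  "Ga n = {v. nprod a 1 v = scale (of_int n) v}"

sublocale Ga: int_graded_space scale Ga
proof -
  have "direct_sum scale Ga"
    using semisimple_integer_direct_sum[OF vector_space_axioms a_1_semisimple a_1_eigenvalues]
    by (simp add: Ga_def[abs_def])
  then show "int_graded_space scale Ga" by (simp add: int_graded_space_def)
qed

text \<open>On lowest components, \<open>a(1)\<close> acts as \<open>\<omega>(1) = L(0)\<close>, so the eigenvalue is the lowest degree.\<close>

lemma deformed_leading:
  assumes u: "u \<in> Ga n" "u \<noteq> 0"
  shows "pr G n u \<noteq> 0" and "u \<in> filtration_ge scale G n"
proof -
  obtain m where m: "pr G m u \<noteq> 0" "u \<in> filtration_ge scale G m"
    using u(2) by (rule leading_component)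
  have "scale (of_int n) (pr G m u) = pr G m (nprod a 1 u)"
    using u(1) by (simp add: Ga_def)
  also have "\<dots> = nprod \<omega> 1 (pr G m u)"
    using pr_nprod[OF a_filtration m(2), of 1] by (simp add: pr_a)
  also have "\<dots> = scale (of_int m) (pr G m u)"
    by (rule omega_1[OF pr_in])
  finally have "n = m" using m(1) by simp
  then show "pr G n u \<noteq> 0" "u \<in> filtration_ge scale G n" using m by simp_all
qed

sublocale leading_gradings scale G Ga
proof unfold_locales
  show "Ga n \<subseteq> filtration_ge scale G n" for n
    using deformed_leading(2) subspace_0[OF subspace_filtration] by blast
  show "u = 0" if "u \<in> Ga n" "pr G n u = 0" for u n
    using deformed_leading(1) that by blast
qed

text \<open>The eigenspaces of \<open>a(1)\<close> grade the vertex algebra; this is where \<open>a(0) = T\<close> enters.\<close>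

lemma nprod_Ga:
  assumes "u \<in> Ga n" and "v \<in> Ga m"
  shows "nprod u k v \<in> Ga (n + m - k - 1)"
proof -
  have u: "nprod a 1 u = scale (of_int n) u" and v: "nprod a 1 v = scale (of_int m) v"
    using assms by (simp_all add: Ga_def)
  have "nprod a 1 (nprod u k v) = nprod u k (nprod a 1 v)
      + (nprod (nprod a 0 u) (k + 1) v + nprod (nprod a 1 u) k v)"
    using commutator_1[of a u k v] by (simp add: algebra_simps)
  also have "\<dots> = scale (of_int m - of_int (k + 1) + of_int n) (nprod u k v)"
    by (simp add: u v a_0 translation_nprod algebra_simps)
  finally show ?thesis by (simp add: Ga_def algebra_simps)
qed

lemma lead_nprod: "lead (nprod x k y) = nprod (lead x) k (lead y)"
proof (induction x rule: Ga.homogeneous_induct)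
  case x: (homogeneous n x)
  show ?case
  proof (induction y rule: Ga.homogeneous_induct)
    case y: (homogeneous m y)
    have "lead (nprod x k y) = pr G (n + m - k - 1) (nprod x k y)"
      by (rule lead_homogeneous[OF nprod_Ga[OF x y]])
    also have "\<dots> = nprod (pr G n x) k (pr G m y)"
      by (rule pr_nprod) (use x y H_filtration in blast)+
    finally show ?case by (simp add: lead_homogeneous[OF x] lead_homogeneous[OF y])
  next
    case (add y z)
    then show ?case by (simp add: lead_add)
  qed
next
  case (add x z)
  then show ?case by (simp add: lead_add)
qed

lemma lead_vac: "lead vac = vac"
proof -
  have "vac \<in> Ga 0" by (simp add: Ga_def vac_right_nonneg)
  then show ?thesis
    using lead_homogeneous pr_homogeneous[OF vac_graded, of 0] by simp
qed

lemma lead_a: "lead a = \<omega>"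
proof -
  have "a \<in> Ga 2" by (simp add: Ga_def a_1_a)
  then show ?thesis by (simp add: lead_homogeneous pr_a)
qed

lemma inv_lead: "inv lead (lead v) = v" "lead (inv lead v) = v"
  using bij_lead by (simp_all add: bij_is_inj bij_is_surj surj_f_inv_f)

lemma inj_lead: "inj lead"
  using bij_lead by (rule bij_is_inj)

lemma inv_lead_homogeneous: "x \<in> G n \<Longrightarrow> inv lead x = pr Ga n x"
  by (metis inv_lead(1) lead_pr_H)

lemma inv_lead_automorphism: "inv lead \<in> va_aut scale nprod vac"
  unfolding va_aut_def
proof (intro CollectI conjI allI)
  interpret l: Vector_Spaces.linear scale scale lead by (rule linear_lead)
  show "Vector_Spaces.linear scale scale (inv lead)"
    unfolding Vector_Spaces.linear_iff
  proof (intro conjI allI vector_space_axioms)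
    show "inv lead (x + y) = inv lead x + inv lead y" for x y
      by (rule inj_lead[THEN injD]) (simp add: inv_lead lead_add)
    show "inv lead (scale c x) = scale c (inv lead x)" for c x
      by (rule inj_lead[THEN injD]) (simp add: inv_lead l.scale)
  qed
  show "bij (inv lead)" by (rule bij_imp_bij_inv[OF bij_lead])
  show "inv lead (nprod x n y) = nprod (inv lead x) n (inv lead y)" for x n y
    by (rule inj_lead[THEN injD]) (simp add: inv_lead lead_nprod)
  show "inv lead vac = vac" by (metis inv_lead(1) lead_vac)
qed

lemma inv_lead_automorphism_plus: "inv lead \<in> va_aut_plus scale nprod vac G"
  unfolding va_aut_plus_def
proof (intro CollectI conjI allI ballI)
  show "inv lead \<in> va_aut scale nprod vac" by (rule inv_lead_automorphism)
  show "inv lead ` G n \<subseteq> filtration_ge scale G n" for n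
    using subsetD[OF H_filtration Ga.pr_in] by (auto simp: inv_lead_homogeneous)
  show "pr G n (inv lead x) = x" if "x \<in> G n" for x n
    using that by (simp add: inv_lead_homogeneous pr_surj)
qed

lemma automorphism_plus_unique:
  assumes "f \<in> va_aut_plus scale nprod vac G" and f_omega: "f \<omega> = a"
  shows "f = inv lead"
proof
  have lin: "Vector_Spaces.linear scale scale f"
    and mult: "\<And>a n b. f (nprod a n b) = nprod (f a) n (f b)"
    and pr_f: "\<And>n x. x \<in> G n \<Longrightarrow> pr G n (f x) = x"
    using assms(1) by (auto simp: va_aut_plus_def va_aut_def)
  interpret f: Vector_Spaces.linear scale scale f by (rule lin)
  fix v
  have "lead (f v) = v"
  proof (induction v rule: homogeneous_induct)
    case (homogeneous n x)
    \<comment> \<open>\<open>f\<close> intertwines \<open>\<omega>(1)\<close> and \<open>a(1)\<close>, so it maps \<open>G n\<close> into \<open>Ga n\<close>.\<close>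
    have "nprod a 1 (f x) = f (nprod \<omega> 1 x)" by (simp add: mult f_omega)
    then have "f x \<in> Ga n" using homogeneous by (simp add: Ga_def omega_1 f.scale)
    then show ?case by (simp add: lead_homogeneous pr_f[OF homogeneous])
  next
    case (add x y)
    then show ?case by (simp add: f.add lead_add)
  qed
  then show "f v = inv lead v" by (metis inv_lead(1))
qed

lemma deformed_conformal_vector:
  "(\<exists>!\<psi>. \<psi> \<in> va_aut_plus scale nprod vac G \<and> \<psi> \<omega> = a)
    \<and> conformal_vector scale nprod vac a"
proof (rule conjI)
  have omega: "inv lead \<omega> = a" using inv_lead(1)[of a] by (simp only: lead_a)
  show "\<exists>!\<psi>. \<psi> \<in> va_aut_plus scale nprod vac G \<and> \<psi> \<omega> = a"
    using inv_lead_automorphism_plus omega automorphism_plus_unique by blast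
  show "conformal_vector scale nprod vac a"
    using conformal_vector_automorphism[OF inv_lead_automorphism] by (simp add: omega)
qed

end

theorem theorem3p1:
  fixes scale :: "'k::real_normed_field \<Rightarrow> 'v::ab_group_add \<Rightarrow> 'v"
    and nprod :: "'v \<Rightarrow> int \<Rightarrow> 'v \<Rightarrow> 'v"
    and vac :: 'v
    and G :: "int \<Rightarrow> 'v set"
    and \<omega> a :: 'v
  assumes "conformal_vertex_algebra scale nprod vac G \<omega>"
    and "a \<in> filtration_ge scale G 2"
    and "pr G 2 a = \<omega>"
    and "nprod a 0 = translation nprod vac"
    and "nprod a 1 a = scale 2 a"
    and "semisimple scale (nprod a 1)"
    and "\<forall>x. is_eigenvalue scale (nprod a 1) x \<longrightarrow> x \<in> \<int>"
  shows "(\<exists>!\<psi>. \<psi> \<in> va_aut_plus scale nprod vac G \<and> \<psi> \<omega> = a)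
    \<and> conformal_vector scale nprod vac a"
  by (rule deformed_conformal.deformed_conformal_vector
      [OF deformed_conformal.intro[OF assms(1) deformed_conformal_axioms.intro[OF assms(2-)]]])

end
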